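(* Let $f_k\in DX$ and suppose that $g_k\in X$ is an $X$-weak upper gradient of $f_k$, $k\in\mathbb N$. Assume further that $f_k\to f$ q.e. and $g_k\to g$ in $X$ as $k\to\infty$, where $f$ is real-valued $\mu$-almost everywhere while $g$ is non-negative. Then $g$ is an $X$-weak upper gradient of $f$.
   Context: Setting: $\mathcal P=(\mathcal P,d,\mu)$ is a metric space equipped with a $\sigma$-finite Borel regular measure $\mu$ (all Borel sets are $\mu$-measurable, and each $\mu$-measurable set $A$ is contained in a Borel set $D$ with $\mu(D)=\mu(A)$) such that every ball has finite positive measure. $\mathcal M(\mathcal P,\mu)$ is the set of all extended real-valued $\mu$-measurable functions on $\mathcal P$. $X$ is a quasi-Banach function lattice: there is a functional $\|\cdot\|_X:\mathcal M(\mathcal P,\mu)\to[0,\infty]$ with (P0) $X=\{u\in\mathcal M(\mathcal P,\mu):\|u\|_X<\infty\}$; (P1) $\|u\|_X=0$ iff $u=0$ a.e., $\|au\|_X=|a|\|u\|_X$ for $a\in\mathbb R$, and there is a constant $c\ge1$ (modulus of concavity) with $\|u+v\|_X\le c(\|u\|_X+\|v\|_X)$ for all $u,v$; (P2) if $|u|\le|v|$ a.e. then $\|u\|_X\le\|v\|_X$; (RF) if $u_n\ge0$ a.e. for all $n\in\mathbb N=\{1,2,\dots\}$, then $\|\sum_{n=1}^\infty u_n\|_X\le\sum_{n=1}^\infty c^n\|u_n\|_X$ (pointwise a.e. sum). The quasi-norm is assumed continuous: $\|u_n-u\|_X\to0$ implies $\|u_n\|_X\to\|u\|_X$. Elements of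 $X$ are functions defined everywhere on $\mathcal P$ (not equivalence classes); they are finite a.e. "$g_k\to g$ in $X$" means $g\in X$ and $\|g_k-g\|_X\to0$. A curve is a rectifiable non-constant continuous map from a compact interval into $\mathcal P$, always parameterized by arc length, $\gamma:[0,l_\gamma]\to\mathcal P$; $ds$ is arc length. The $X$-modulus of a family $\Gamma$ of curves is $\mathrm{Mod}_X(\Gamma)=\inf\|\rho\|_X$ over all Borel $\rho:\mathcal P\to[0,\infty]$ with $\int_\gamma\rho\,ds\ge1$ for all $\gamma\in\Gamma$. A property holds for $\mathrm{Mod}_X$-a.e. curve if the exceptional family has zero $X$-modulus. For a non-negative measurable $g$, $\int_\gamma g\,ds$ is well defined in $[0,\infty]$ for $\mathrm{Mod}_X$-a.e. $\gamma$. A Borel function $g:\mathcal P\to[0,\infty]$ is an upper gradient of $u:\mathcal P\to\mathbb R\cup\{\pm\infty\}$ if $|u(\gamma(0))-u(\gamma(l_\gamma))|\le\int_\gamma g\,ds$ for all curves $\gamma$, with the convention $|(\pm\infty)-(\pm\infty)|=\infty$. A non-negative (possibly $\infty$-valued) $\mu$-measurable $g$ is an $X$-weak upper gradient of $u$ if this inequality holds for $\mathrm{Mod}_X$-a.e. curve. The Dirichlet space $DX$ is the set of measurable (extended real-valued) functions having an upper gradient in $X$. The Newtonian space is $N^1X=X\cap DX$ (functions defined everywhere) with $\|u\|_{N^1X}=\|u\|_X+\inf_g\|g\|_X$, the infimum over all upper gradients $g$ of $u$ ($\|u\|_{N^1X}=\infty$ for measurable $u\notin N^1X$). The Sobolev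 $X$-capacity of $E\subset\mathcal P$ is $C_X(E)=\inf\{\|u\|_{N^1X}:u\ge1\text{ on }E\}$. A property holds quasi-everywhere (q.e.) if the set of exceptional points has $X$-capacity zero. *)

theory Defs
  imports "HOL-Analysis.Analysis"
begin

locale borel_regular_metric_measure_space = sigma_finite_measure M
  for M :: "'a::metric_space measure" +
  assumes space_eq_UNIV: "space M = UNIV"
    and borel_subset_sets: "sets borel \<subseteq> sets M"
    and borel_regular:
      "\<And>A. A \<in> sets M \<Longrightarrow> \<exists>D \<in> sets borel. A \<subseteq> D \<and> emeasure M D = emeasure M A"
    and ball_pos: "\<And>x r. 0 < r \<Longrightarrow> 0 < emeasure M (ball x r)"
    and ball_finite: "\<And>x r. 0 < r \<Longrightarrow> emeasure M (ball x r) < \<infinity>"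

definition lattice_space :: "'a measure \<Rightarrow> (('a \<Rightarrow> ereal) \<Rightarrow> ennreal) \<Rightarrow> ('a \<Rightarrow> ereal) set"
  where "lattice_space M nrm = {u \<in> borel_measurable M. nrm u < \<infinity>}"

text \<open>
  The functional \<open>nrm\<close> is only constrained on measurable functions.  The library value of the
  undefined sum \<open>\<infinity> + (-\<infinity>)\<close> in \<^typ>\<open>ereal\<close> is harmless below: by homogeneity and the lattice
  property, functions of finite quasi-norm are finite almost everywhere, so it only occurs
  on null sets or when the right-hand side of \<open>quasi_triangle\<close> is infinite.  In \<open>riesz_fischer\<close>,
  \<open>v\<close> is any version of the sum, which is only determined almost everywhere; the
  sequence is indexed from \<open>0\<close>, hence the exponent \<open>Suc n\<close>.
\<close>

locale quasi_Banach_function_lattice =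
  borel_regular_metric_measure_space M
  for M :: "'a::metric_space measure" +
  fixes nrm :: "('a \<Rightarrow> ereal) \<Rightarrow> ennreal" and c :: real
  assumes c_ge_1: "1 \<le> c"
    and norm_eq_0_iff:
      "\<And>u. u \<in> borel_measurable M \<Longrightarrow> nrm u = 0 \<longleftrightarrow> (AE x in M. u x = 0)"
    and norm_scale:
      "\<And>u a. u \<in> borel_measurable M \<Longrightarrow>
        nrm (\<lambda>x. ereal a * u x) = ennreal \<bar>a\<bar> * nrm u"
    and quasi_triangle:
      "\<And>u v. u \<in> borel_measurable M \<Longrightarrow> v \<in> borel_measurable M \<Longrightarrow>
        nrm (\<lambda>x. u x + v x) \<le> ennreal c * (nrm u + nrm v)"
    and norm_mono:
      "\<And>u v. u \<in> borel_measurable M \<Longrightarrow> v \<in> borel_measurable M \<Longrightarrow>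
        (AE x in M. \<bar>u x\<bar> \<le> \<bar>v x\<bar>) \<Longrightarrow> nrm u \<le> nrm v"
    and riesz_fischer:
      "\<And>(u :: nat \<Rightarrow> 'a \<Rightarrow> ereal) v.
        (\<And>n. u n \<in> borel_measurable M) \<Longrightarrow> (\<And>n. AE x in M. 0 \<le> u n x) \<Longrightarrow>
        v \<in> borel_measurable M \<Longrightarrow> (AE x in M. v x = (\<Sum>n. u n x)) \<Longrightarrow>
        nrm v \<le> (\<Sum>n. ennreal c ^ Suc n * nrm (u n))"

definition converges_in :: "'a measure \<Rightarrow> (('a \<Rightarrow> ereal) \<Rightarrow> ennreal) \<Rightarrow>
    (nat \<Rightarrow> 'a \<Rightarrow> ereal) \<Rightarrow> ('a \<Rightarrow> ereal) \<Rightarrow> bool"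
  where "converges_in M nrm u v \<longleftrightarrow>
    v \<in> lattice_space M nrm \<and> (\<lambda>n. nrm (\<lambda>x. u n x - v x)) \<longlonglongrightarrow> 0"

definition continuous_quasi_norm :: "'a measure \<Rightarrow> (('a \<Rightarrow> ereal) \<Rightarrow> ennreal) \<Rightarrow> bool"
  where "continuous_quasi_norm M nrm \<longleftrightarrow>
    (\<forall>u v. (\<forall>n. u n \<in> lattice_space M nrm) \<and> converges_in M nrm u v \<longrightarrow>
      (\<lambda>n. nrm (u n)) \<longlonglongrightarrow> nrm v)"

definition curve_length :: "(real \<Rightarrow> 'a::metric_space) \<Rightarrow> real \<Rightarrow> real \<Rightarrow> ennreal"
  where "curve_length \<gamma> a b =
    (SUP ts \<in> {ts. sorted ts \<and> set ts \<subseteq> {a..b}}.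
      \<Sum>i < length ts - 1. ennreal (dist (\<gamma> (ts ! i)) (\<gamma> (ts ! Suc i))))"

text \<open>
  A curve is a pair \<open>(l, \<gamma>)\<close>, where only the values of \<open>\<gamma>\<close> on \<open>{0..l}\<close> matter.  Parameterization by
  arc length makes \<open>\<gamma>\<close> rectifiable of length \<open>l\<close>, and non-constant exactly because \<open>0 < l\<close>.
\<close>

definition curves :: "(real \<times> (real \<Rightarrow> 'a::metric_space)) set"
  where "curves = {(l, \<gamma>). 0 < l \<and> continuous_on {0..l} \<gamma> \<and>
    (\<forall>t \<in> {0..l}. curve_length \<gamma> 0 t = ennreal t)}"

text \<open>
  The line integral is meant for non-negative \<open>g\<close> only, since \<^const>\<open>e2ennreal\<close> truncates negative
  values; it is well defined when \<open>g \<circ> \<gamma>\<close> is Lebesgue measurable.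
\<close>

fun line_integral :: "(real \<times> (real \<Rightarrow> 'a)) \<Rightarrow> ('a \<Rightarrow> ereal) \<Rightarrow> ennreal"
  where "line_integral (l, \<gamma>) g = (\<integral>\<^sup>+ t \<in> {0..l}. e2ennreal (g (\<gamma> t)) \<partial>lebesgue)"

fun line_measurable :: "(real \<times> (real \<Rightarrow> 'a)) \<Rightarrow> ('a \<Rightarrow> ereal) \<Rightarrow> bool"
  where "line_measurable (l, \<gamma>) g \<longleftrightarrow>
    (\<lambda>t. g (\<gamma> t)) \<in> borel_measurable (lebesgue_on {0..l})"

definition modulus :: "(('a::metric_space \<Rightarrow> ereal) \<Rightarrow> ennreal) \<Rightarrow>
    (real \<times> (real \<Rightarrow> 'a)) set \<Rightarrow> ennreal"
  where "modulus nrm \<Gamma> =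
    (INF \<rho> \<in> {\<rho> \<in> borel_measurable borel. (\<forall>x. 0 \<le> \<rho> x) \<and> (\<forall>\<gamma> \<in> \<Gamma>. 1 \<le> line_integral \<gamma> \<rho>)}. nrm \<rho>)"

definition ae_curve :: "(('a::metric_space \<Rightarrow> ereal) \<Rightarrow> ennreal) \<Rightarrow>
    (real \<times> (real \<Rightarrow> 'a) \<Rightarrow> bool) \<Rightarrow> bool"
  where "ae_curve nrm P \<longleftrightarrow> modulus nrm {\<gamma> \<in> curves. \<not> P \<gamma>} = 0"

text \<open>
  The difference of equal infinities is \<open>\<infinity>\<close> in \<^typ>\<open>ereal\<close>, so the convention
  \<open>\<bar>(\<plusminus>\<infinity>) - (\<plusminus>\<infinity>)\<bar> = \<infinity>\<close> is built in.
\<close>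

lemma abs_infinity_diff:
  "\<bar>\<infinity> - \<infinity>\<bar> = (\<infinity> :: ereal)" "\<bar>(-\<infinity>) - (-\<infinity>)\<bar> = (\<infinity> :: ereal)"
  "\<bar>\<infinity> - (-\<infinity>)\<bar> = (\<infinity> :: ereal)" "\<bar>(-\<infinity>) - \<infinity>\<bar> = (\<infinity> :: ereal)"
  by simp_all

fun gradient_inequality :: "('a \<Rightarrow> ereal) \<Rightarrow> ('a \<Rightarrow> ereal) \<Rightarrow> (real \<times> (real \<Rightarrow> 'a)) \<Rightarrow> bool"
  where "gradient_inequality g u (l, \<gamma>) \<longleftrightarrow>
    \<bar>u (\<gamma> 0) - u (\<gamma> l)\<bar> \<le> enn2ereal (line_integral (l, \<gamma>) g)"

definition upper_gradient :: "('a::metric_space \<Rightarrow> ereal) \<Rightarrow> ('a \<Rightarrow> ereal) \<Rightarrow> bool"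
  where "upper_gradient g u \<longleftrightarrow>
    g \<in> borel_measurable borel \<and> (\<forall>x. 0 \<le> g x) \<and> (\<forall>\<gamma> \<in> curves. gradient_inequality g u \<gamma>)"

definition weak_upper_gradient :: "'a::metric_space measure \<Rightarrow> (('a \<Rightarrow> ereal) \<Rightarrow> ennreal) \<Rightarrow>
    ('a \<Rightarrow> ereal) \<Rightarrow> ('a \<Rightarrow> ereal) \<Rightarrow> bool"
  where "weak_upper_gradient M nrm g u \<longleftrightarrow>
    g \<in> borel_measurable M \<and> (\<forall>x. 0 \<le> g x) \<and>
    ae_curve nrm (\<lambda>\<gamma>. line_measurable \<gamma> g \<and> gradient_inequality g u \<gamma>)"

definition dirichlet_space :: "'a::metric_space measure \<Rightarrow> (('a \<Rightarrow> ereal) \<Rightarrow> ennreal) \<Rightarrow>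
    ('a \<Rightarrow> ereal) set"
  where "dirichlet_space M nrm =
    {u \<in> borel_measurable M. \<exists>g \<in> lattice_space M nrm. upper_gradient g u}"

text \<open>
  For measurable \<open>u\<close>, this is \<open>\<infinity>\<close> unless both \<open>u\<close> and some upper gradient of \<open>u\<close> lie in \<open>X\<close>.
\<close>

definition newtonian_norm :: "(('a::metric_space \<Rightarrow> ereal) \<Rightarrow> ennreal) \<Rightarrow> ('a \<Rightarrow> ereal) \<Rightarrow> ennreal"
  where "newtonian_norm nrm u = nrm u + (INF g \<in> {g. upper_gradient g u}. nrm g)"

definition sobolev_capacity :: "'a::metric_space measure \<Rightarrow> (('a \<Rightarrow> ereal) \<Rightarrow> ennreal) \<Rightarrow>
    'a set \<Rightarrow> ennreal"
  where "sobolev_capacity M nrm E =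
    (INF u \<in> {u \<in> borel_measurable M. \<forall>x \<in> E. 1 \<le> u x}. newtonian_norm nrm u)"

definition quasi_everywhere :: "'a::metric_space measure \<Rightarrow> (('a \<Rightarrow> ereal) \<Rightarrow> ennreal) \<Rightarrow>
    ('a \<Rightarrow> bool) \<Rightarrow> bool"
  where "quasi_everywhere M nrm P \<longleftrightarrow> sobolev_capacity M nrm {x. \<not> P x} = 0"

end

theory Submission
  imports Defs
begin

text \<open>
  The idea is to find, for almost every curve \<open>(l, \<gamma>)\<close>, enough convergence along the curve itself to
  pass to the limit in \<open>\<bar>f\<^sub>k(\<gamma>(0)) - f\<^sub>k(\<gamma>(l))\<bar> \<le> \<integral>\<^sub>\<gamma> g\<^sub>k\<close>.

  On the left, \<open>f\<^sub>k \<rightarrow> f\<close> at \<^emph>\<open>every\<close> point of almost every curve, because almost every curve avoids a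
  given set \<open>E\<close> of capacity zero (\<open>ae_curve_avoids_capacity_zero\<close>): test functions \<open>u\<^sub>n \<ge> 1\<close> on \<open>E\<close> whose
  norms, and those of their upper gradients \<open>\<rho>\<^sub>n\<close>, decay fast have \<open>\<Sum>\<^sub>n \<bar>u\<^sub>n\<bar> < \<infinity>\<close> almost everywhere and
  \<open>\<Sum>\<^sub>n \<integral>\<^sub>\<gamma> \<rho>\<^sub>n < \<infinity>\<close> for almost every curve.  So \<open>u\<^sub>n \<rightarrow> 0\<close> at some point of the curve, the oscillation of
  \<open>u\<^sub>n\<close> along the curve tends to \<open>0\<close> as well, and \<open>u\<^sub>n \<ge> 1\<close> is impossible on the whole curve eventually.

  On the right, a subsequence satisfies \<open>\<integral>\<^sub>\<gamma> \<bar>g\<^sub>k - g\<bar> \<rightarrow> 0\<close> for almost every curve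
  (\<open>fuglede_subsequence\<close>).

  The limit of the left-hand side is \<open>\<bar>f(\<gamma>(0)) - f(\<gamma>(l))\<bar>\<close> whenever \<open>f\<close> is finite at one of the end points
  (\<open>gradient_inequality_limit\<close>).  If it is infinite at both, the convention \<open>\<bar>\<infinity> - \<infinity>\<bar> = \<infinity>\<close> asks for
  \<open>\<integral>\<^sub>\<gamma> g = \<infinity>\<close>.  As \<open>{\<bar>f\<bar> = \<infinity>}\<close> is a null set, almost every curve leaves it at some \<open>\<gamma>(t)\<close>, and the
  inequality on the initial segment \<open>[0, t]\<close>, which has a finite end, already makes the
  integral infinite (\<open>gradient_inequality_infinite_ends\<close>).  This uses that a property of almost every
  curve also holds on all initial segments of almost every curve (\<open>ae_curve_initial\<close>).

  All statements about almost every curve go through one reformulation of modulus zero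
  (\<open>ae_curve_iff\<close>): a single Borel weight of finite norm has infinite integral over every
  exceptional curve.
\<close>

section \<open>Borel representatives of measurable functions\<close>

context borel_regular_metric_measure_space
begin

lemma borel_measurable_M: "f \<in> borel_measurable borel \<Longrightarrow> f \<in> borel_measurable M"
  using borel_subset_sets by (auto simp: measurable_def space_eq_UNIV)

lemma borel_null_superset:
  assumes "AE x in M. Q x"
  obtains D where "D \<in> sets borel" "D \<in> null_sets M" "\<And>x. x \<notin> D \<Longrightarrow> Q x"
proof -
  obtain N where N: "{x \<in> space M. \<not> Q x} \<subseteq> N" "N \<in> sets M" "emeasure M N = 0"
    using assms by (rule AE_E)
  obtain D where D: "D \<in> sets borel" "N \<subseteq> D" "emeasure M D = emeasure M N"
    using borel_regular[OF N(2)] by blast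
  show thesis
  proof
    show "D \<in> sets borel" by fact
    show "D \<in> null_sets M" using D N borel_subset_sets by auto
    show "Q x" if "x \<notin> D" for x using that D N space_eq_UNIV by auto
  qed
qed

text \<open>
  Borel regularity gives a cover of the same measure, which differs from the set by a null set only
  when that measure is finite; \<open>\<sigma>\<close>-finiteness reduces the general case to this one.
\<close>

lemma borel_hull:
  assumes A: "A \<in> sets M"
  obtains B where "B \<in> sets borel" "A \<subseteq> B" "B - A \<in> null_sets M"
proof -
  obtain S :: "nat \<Rightarrow> 'a set" where S: "range S \<subseteq> sets M" "(\<Union>i. S i) = space M"
      "\<And>i. emeasure M (S i) \<noteq> \<infinity>"
    using sigma_finite by blast
  have "\<exists>D. D \<in> sets borel \<and> A \<inter> S i \<subseteq> D \<and> emeasure M D = emeasure M (A \<inter> S i)" for i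
    using borel_regular[of "A \<inter> S i"] S(1) A by blast
  then obtain D where D: "\<And>i. D i \<in> sets borel" "\<And>i. A \<inter> S i \<subseteq> D i"
      "\<And>i. emeasure M (D i) = emeasure M (A \<inter> S i)"
    by metis
  have DM: "D i \<in> sets M" for i using D(1) borel_subset_sets by blast
  have SM: "S i \<in> sets M" for i using S(1) by blast
  have null: "D i - A \<in> null_sets M" for i
  proof -
    have fin: "emeasure M (A \<inter> S i) \<noteq> \<infinity>"
      using emeasure_mono[of "A \<inter> S i" "S i" M] S(3)[of i] SM by (auto simp: top_unique)
    have "emeasure M (D i - A \<inter> S i) = emeasure M (D i) - emeasure M (A \<inter> S i)"
      using fin D(2) DM A SM by (intro emeasure_Diff) auto
    also have "\<dots> = 0"
      using D(3) fin by simp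
    finally have "D i - A \<inter> S i \<in> null_sets M"
      using DM A SM by auto
    then show ?thesis
      using DM A by (rule_tac null_sets_subset) auto
  qed
  show thesis
  proof
    show "(\<Union>i. D i) \<in> sets borel" using D(1) by auto
    show "A \<subseteq> (\<Union>i. D i)"
    proof
      fix x assume "x \<in> A"
      moreover have "x \<in> (\<Union>i. S i)" using S(2) space_eq_UNIV by simp
      ultimately show "x \<in> (\<Union>i. D i)" using D(2) by blast
    qed
    have "(\<Union>i. D i) - A = (\<Union>i. D i - A)" by auto
    then show "(\<Union>i. D i) - A \<in> null_sets M"
      using null_sets_UN[of "\<lambda>i. D i - A" M] null by simp
  qed
qed

text \<open>
  Admissible weights in the modulus are Borel, whereas gradients and their differences are only
  measurable with respect to \<^term>\<open>M\<close>.  Every \<^term>\<open>M\<close>-measurable set is a Borel set up to a subset of a Borel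
  null set, so \<^term>\<open>h\<close> is measurable for the completion of the Borel restriction of \<^term>\<open>M\<close> and agrees almost
  everywhere with a Borel function; the value \<open>\<infinity>\<close> on the exceptional null set makes this function a
  pointwise majorant.
\<close>

lemma borel_majorant:
  fixes h :: "'a \<Rightarrow> ennreal"
  assumes h: "h \<in> borel_measurable M"
  obtains h' where "h' \<in> borel_measurable borel" "\<And>x. h x \<le> h' x" "AE x in M. h' x = h x"
proof -
  define N where "N = distr M borel (\<lambda>x. x)"
  have id: "(\<lambda>x. x) \<in> measurable M borel"
    by (rule borel_measurable_M) simp
  have em: "emeasure N A = emeasure M A" if "A \<in> sets borel" for A
    using that unfolding N_def by (simp add: emeasure_distr[OF id] space_eq_UNIV)
  have sN: "sets N = sets borel" "space N = UNIV"
    unfolding N_def by auto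
  have sub: "A \<in> sets (completion N)" if A: "A \<in> sets M" for A
  proof -
    \<comment> \<open>the complement of a Borel hull of the complement of \<open>A\<close> is a Borel kernel of \<open>A\<close>\<close>
    have "UNIV - A \<in> sets M"
      using sets.compl_sets[OF A] space_eq_UNIV by simp
    then obtain E where E: "E \<in> sets borel" "UNIV - A \<subseteq> E" "E - (UNIV - A) \<in> null_sets M"
      by (rule borel_hull)
    obtain D where D: "D \<in> sets borel" "E - (UNIV - A) \<subseteq> D"
        "emeasure M D = emeasure M (E - (UNIV - A))"
      using borel_regular[of "E - (UNIV - A)"] E(3) by blast
    show ?thesis
    proof (rule sets_completionI)
      show "A = (UNIV - E) \<union> (E - (UNIV - A))" using E(2) by auto
      show "E - (UNIV - A) \<subseteq> D" by fact
      have "emeasure N D = 0" using D em[OF D(1)] null_setsD1[OF E(3)] by simp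
      then show "D \<in> null_sets N" using D(1) sN by (intro null_setsI) simp_all
      show "UNIV - E \<in> sets N" using E(1) sN by auto
    qed
  qed
  have "h \<in> borel_measurable (completion N)"
    using h sub by (auto simp: measurable_def space_eq_UNIV sN)
  from completion_ex_borel_measurable[OF this]
  obtain k where k: "k \<in> borel_measurable N" "AE x in N. h x = k x" by blast
  have "AE x in M. h x = k x"
    using AE_distrD[OF id k(2)[unfolded N_def]] by simp
  then obtain D where D: "D \<in> sets borel" "D \<in> null_sets M" "\<And>x. x \<notin> D \<Longrightarrow> h x = k x"
    by (rule borel_null_superset) blast
  have kb: "k \<in> borel_measurable borel"
    using k(1) by (simp add: N_def)
  show thesis
  proof
    show "(\<lambda>x. if x \<in> D then \<infinity> else k x) \<in> borel_measurable borel"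
      using D(1) kb by measurable
    show "h x \<le> (if x \<in> D then \<infinity> else k x)" for x
      using D(3) by auto
    show "AE x in M. (if x \<in> D then \<infinity> else k x) = h x"
      using AE_not_in[OF D(2)] by eventually_elim (use D(3) in auto)
  qed
qed

end

section \<open>Integrals along curves\<close>

text \<open>
  Integrands with values in \<^typ>\<open>ennreal\<close> have the calculus of the non-negative integral available;
  extended real gradients enter through \<^const>\<open>e2ennreal\<close>.
\<close>

definition curve_integral :: "real \<times> (real \<Rightarrow> 'a) \<Rightarrow> ('a \<Rightarrow> ennreal) \<Rightarrow> ennreal"
  where "curve_integral p \<rho> = (\<integral>\<^sup>+ t. \<rho> (snd p t) \<partial>lebesgue_on {0..fst p})"

definition curve_measurable :: "real \<times> (real \<Rightarrow> 'a) \<Rightarrow> ('a \<Rightarrow> ennreal) \<Rightarrow> bool"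
  where "curve_measurable p \<rho> \<longleftrightarrow> (\<lambda>t. \<rho> (snd p t)) \<in> borel_measurable (lebesgue_on {0..fst p})"

lemma line_integral_eq: "line_integral p g = curve_integral p (\<lambda>x. e2ennreal (g x))"
  by (cases p) (simp add: curve_integral_def nn_integral_restrict_space)

lemma line_measurable_iff:
  assumes "\<And>x. 0 \<le> g x"
  shows "line_measurable p g \<longleftrightarrow> curve_measurable p (\<lambda>x. e2ennreal (g x))"
proof (cases p)
  case (Pair l \<gamma>)
  have "(\<lambda>t. g (\<gamma> t)) = (\<lambda>t. enn2ereal (e2ennreal (g (\<gamma> t))))"
    using assms by (simp add: enn2ereal_e2ennreal)
  then show ?thesis
    unfolding Pair curve_measurable_def line_measurable.simps fst_conv snd_conv
    by (metis measurable_compose[OF _ measurable_e2ennreal] measurable_compose[OF _ measurable_enn2ereal])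
qed

lemma curve_measurable_borel:
  fixes p :: "real \<times> (real \<Rightarrow> 'a::metric_space)"
  assumes "p \<in> curves" "\<rho> \<in> borel_measurable borel"
  shows "curve_measurable p \<rho>"
proof (cases p)
  case (Pair l \<gamma>)
  have "continuous_on {0..l} \<gamma>"
    using assms(1) by (simp add: Pair curves_def)
  then have "\<gamma> \<in> borel_measurable (restrict_space borel {0..l})"
    by (rule borel_measurable_continuous_on_restrict)
  then have "\<gamma> \<in> measurable (lebesgue_on {0..l}) borel"
    by (auto simp: measurable_def space_restrict_space sets_restrict_space)
  then show ?thesis
    unfolding Pair curve_measurable_def fst_conv snd_conv
    using assms(2) by (rule measurable_compose)
qed

lemma curve_integral_mono_AE:
  "AE t in lebesgue_on {0..fst p}. \<rho> (snd p t) \<le> \<sigma> (snd p t) \<Longrightarrow>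
    curve_integral p \<rho> \<le> curve_integral p \<sigma>"
  unfolding curve_integral_def by (rule nn_integral_mono_AE)

lemma curve_integral_suminf:
  assumes "\<And>n. curve_measurable p (\<rho> n)"
  shows "curve_integral p (\<lambda>x. \<Sum>n. \<rho> n x) = (\<Sum>n. curve_integral p (\<rho> n))"
  using assms unfolding curve_integral_def curve_measurable_def by (rule nn_integral_suminf)

lemma curve_integral_cmult:
  "curve_measurable p \<rho> \<Longrightarrow> curve_integral p (\<lambda>x. a * \<rho> x) = a * curve_integral p \<rho>"
  unfolding curve_integral_def curve_measurable_def by (rule nn_integral_cmult)

lemma curve_integral_add:
  "curve_measurable p \<rho> \<Longrightarrow> curve_measurable p \<sigma> \<Longrightarrow>
    curve_integral p (\<lambda>x. \<rho> x + \<sigma> x) = curve_integral p \<rho> + curve_integral p \<sigma>"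
  unfolding curve_integral_def curve_measurable_def by (rule nn_integral_add)

lemma curve_integral_initial:
  assumes "t \<le> l"
  shows "curve_integral (t, \<gamma>) \<rho> \<le> curve_integral (l, \<gamma>) \<rho>"
  using assms unfolding curve_integral_def
  by (auto simp: nn_integral_restrict_space intro!: nn_integral_mono split: split_indicator)

lemma initial_segment_curves:
  assumes "(l, \<gamma>) \<in> curves" "0 < t" "t \<le> l"
  shows "(t, \<gamma>) \<in> curves"
  using assms unfolding curves_def by (auto intro: continuous_on_subset)

lemma ennreal_suminf_finite_imp_tendsto_0:
  fixes f :: "nat \<Rightarrow> ennreal"
  assumes "(\<Sum>n. f n) < \<infinity>"
  shows "f \<longlonglongrightarrow> 0"
proof -
  have "f n < \<infinity>" for n
    using assms by (rule ennreal_suminf_lessD)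
  then have f: "ennreal (enn2real (f n)) = f n" for n
    by (simp add: ennreal_enn2real)
  have "summable (\<lambda>n. enn2real (f n))"
  proof (rule ccontr)
    assume "\<not> ?thesis"
    then have "(\<Sum>n. ennreal (enn2real (f n))) = top"
      by (rule summable_iff_suminf_neq_top[rotated]) simp
    then show False
      using assms by (simp only: f) simp
  qed
  then have "(\<lambda>n. ennreal (enn2real (f n))) \<longlonglongrightarrow> 0"
    by (simp add: ennreal_tendsto_0_iff summable_LIMSEQ_zero)
  then show ?thesis
    by (simp only: f)
qed

lemma (in complete_measure) measurable_AE_eq:
  fixes f g :: "'a \<Rightarrow> 'b::topological_space"
  assumes f: "f \<in> borel_measurable M" and ae: "AE x in M. f x = g x"
  shows "g \<in> borel_measurable M"
proof (rule measurableI)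
  fix A :: "'b set" assume "A \<in> sets borel"
  then have "f -` A \<inter> space M \<in> sets M"
    using f by (rule measurable_sets[rotated])
  moreover have "AE x in M. x \<in> f -` A \<inter> space M \<longleftrightarrow> x \<in> g -` A \<inter> space M"
    using ae by eventually_elim auto
  ultimately show "g -` A \<inter> space M \<in> sets M"
    by (metis in_sets_AE inf_le2)
qed simp

lemma complete_measure_lebesgue_on:
  assumes S: "S \<in> sets lebesgue"
  shows "complete_measure (lebesgue_on S)"
proof
  fix A B assume "B \<subseteq> A" "A \<in> null_sets (lebesgue_on S)"
  then have "B \<subseteq> S" "B \<in> sets lebesgue"
    using completion.complete[of B A lborel] by (auto simp: null_sets_restrict_space[OF S])
  then show "B \<in> sets (lebesgue_on S)"
    using S by (simp add: sets_restrict_space_iff)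
qed

context quasi_Banach_function_lattice
begin

section \<open>The quasi-norm of a weight\<close>

definition wnorm :: "('a \<Rightarrow> ennreal) \<Rightarrow> ennreal"
  where "wnorm \<rho> = nrm (\<lambda>x. enn2ereal (\<rho> x))"

lemma wnorm_mono:
  assumes "\<rho> \<in> borel_measurable M" "\<sigma> \<in> borel_measurable M" "AE x in M. \<rho> x \<le> \<sigma> x"
  shows "wnorm \<rho> \<le> wnorm \<sigma>"
  unfolding wnorm_def
proof (rule norm_mono)
  show "AE x in M. \<bar>enn2ereal (\<rho> x)\<bar> \<le> \<bar>enn2ereal (\<sigma> x)\<bar>"
    using assms(3) by eventually_elim (simp add: less_eq_ennreal.rep_eq)
qed (use assms in measurable)

lemma wnorm_eq_0_iff:
  assumes "\<rho> \<in> borel_measurable M"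
  shows "wnorm \<rho> = 0 \<longleftrightarrow> (AE x in M. \<rho> x = 0)"
proof -
  have "wnorm \<rho> = 0 \<longleftrightarrow> (AE x in M. enn2ereal (\<rho> x) = 0)"
    unfolding wnorm_def by (rule norm_eq_0_iff) (use assms in measurable)
  then show ?thesis
    by (simp add: zero_ennreal.rep_eq[symmetric] enn2ereal_inject)
qed

lemma wnorm_scale:
  assumes "\<rho> \<in> borel_measurable M" "0 \<le> a"
  shows "wnorm (\<lambda>x. ennreal a * \<rho> x) = ennreal a * wnorm \<rho>"
proof -
  have "(\<lambda>x. enn2ereal (\<rho> x)) \<in> borel_measurable M"
    using assms(1) by measurable
  from norm_scale[OF this, of a] show ?thesis
    using assms(2) unfolding wnorm_def by (simp add: times_ennreal.rep_eq enn2ereal_ennreal)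
qed

lemma wnorm_suminf:
  assumes "\<And>n. \<rho> n \<in> borel_measurable M"
  shows "wnorm (\<lambda>x. \<Sum>n. \<rho> n x) \<le> (\<Sum>n. ennreal c ^ Suc n * wnorm (\<rho> n))"
  unfolding wnorm_def
proof (rule riesz_fischer)
  show "(\<lambda>x. enn2ereal (\<Sum>n. \<rho> n x)) \<in> borel_measurable M"
    using assms by measurable
qed (use assms in \<open>auto intro: measurable_compose[OF _ measurable_enn2ereal]\<close>)

text \<open>
  The Riesz-Fischer property multiplies the \<open>n\<close>-th norm (counted from \<open>0\<close>) by \<open>c\<close> to the power \<open>n + 1\<close>;
  norms bounded by this rate leave the geometric series with sum \<open>1\<close>.
\<close>

definition rate :: "nat \<Rightarrow> real"
  where "rate n = (1 / (2 * c)) ^ Suc n"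

lemma rate_pos: "0 < rate n"
  using c_ge_1 by (simp add: rate_def)

lemma wnorm_suminf_le_1:
  assumes "\<And>n. \<rho> n \<in> borel_measurable M" "\<And>n. wnorm (\<rho> n) \<le> ennreal (rate n)"
  shows "wnorm (\<lambda>x. \<Sum>n. \<rho> n x) \<le> 1"
proof -
  have "ennreal c ^ Suc n * wnorm (\<rho> n) \<le> ennreal ((1/2) ^ Suc n)" for n
  proof -
    have "ennreal c ^ Suc n * wnorm (\<rho> n) \<le> ennreal c ^ Suc n * ennreal (rate n)"
      by (intro mult_left_mono assms) simp
    also have "\<dots> = ennreal (c ^ Suc n * rate n)"
      using c_ge_1 rate_pos[of n] by (simp add: ennreal_power ennreal_mult del: power_Suc)
    also have "c ^ Suc n * rate n = (1/2) ^ Suc n"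
      using c_ge_1 unfolding rate_def by (simp add: power_mult_distrib[symmetric] del: power_Suc)
    finally show ?thesis .
  qed
  then have "(\<Sum>n. ennreal c ^ Suc n * wnorm (\<rho> n)) \<le> (\<Sum>n. ennreal ((1/2) ^ Suc n))"
    by (intro suminf_le) auto
  also have "\<dots> = ennreal 1"
    using power_half_series by (intro suminf_ennreal_eq) auto
  finally show ?thesis
    using order_trans[OF wnorm_suminf[of \<rho>, OF assms(1)]] by simp
qed

text \<open>
  The weight that is \<open>\<infinity>\<close> where \<^term>\<open>\<rho>\<close> is \<open>\<infinity>\<close>, and \<open>0\<close> elsewhere, lies below every positive multiple
  of \<^term>\<open>\<rho>\<close>, so its norm is arbitrarily small.
\<close>

lemma wnorm_finite_imp_AE:
  assumes \<rho>: "\<rho> \<in> borel_measurable M" and fin: "wnorm \<rho> < \<infinity>"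
  shows "AE x in M. \<rho> x < \<infinity>"
proof -
  define w where "w x = (if \<rho> x = \<infinity> then \<infinity> else 0 :: ennreal)" for x
  have w: "w \<in> borel_measurable M"
    using \<rho> unfolding w_def by measurable
  obtain r where r: "wnorm \<rho> = ennreal r" "0 \<le> r"
    using fin by (cases "wnorm \<rho>") auto
  have "wnorm w \<le> 0 + ennreal e" if e: "0 < e" for e
  proof -
    define a where "a = e / (r + 1)"
    have a: "0 < a" "a * r \<le> e"
      using e r by (auto simp: a_def field_simps)
    have "wnorm w \<le> wnorm (\<lambda>x. ennreal a * \<rho> x)"
    proof (rule wnorm_mono)
      show "AE x in M. w x \<le> ennreal a * \<rho> x"
        using a by (auto simp: w_def ennreal_mult_top)
    qed (use w \<rho> in measurable)
    also have "\<dots> = ennreal (a * r)"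
      using wnorm_scale[OF \<rho>, of a] a r by (simp add: ennreal_mult)
    finally show ?thesis
      using a by (simp add: ennreal_leI order_trans)
  qed
  then have "wnorm w = 0"
    using ennreal_le_epsilon[of 0 "wnorm w"] by auto
  then have "AE x in M. w x = 0"
    using wnorm_eq_0_iff[OF w] by simp
  then show ?thesis
    by eventually_elim (auto simp: w_def less_top split: if_splits)
qed

section \<open>Properties of almost every curve\<close>

text \<open>
  If the modulus vanishes, the sum of a sequence of admissible weights with norms below
  \<^const>\<open>rate\<close> has finite norm, and its integral over each exceptional curve is at least a sum of ones.
  Conversely, if a weight has infinite integral over the exceptional curves, all its positive multiples
  are admissible, and their norms are arbitrarily small.
\<close>

lemma ae_curve_iff:
  "ae_curve nrm P \<longleftrightarrow> (\<exists>\<rho>\<in>borel_measurable borel. wnorm \<rho> < \<infinity> \<and>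
    (\<forall>p\<in>curves. curve_integral p \<rho> < \<infinity> \<longrightarrow> P p))"
proof
  assume ae: "ae_curve nrm P"
  have "\<exists>r. (r \<in> borel_measurable borel \<and> (\<forall>x. 0 \<le> r x) \<and>
      (\<forall>\<gamma>\<in>{\<gamma> \<in> curves. \<not> P \<gamma>}. 1 \<le> line_integral \<gamma> r)) \<and> nrm r < ennreal (rate n)" for n
  proof -
    have "modulus nrm {\<gamma> \<in> curves. \<not> P \<gamma>} < ennreal (rate n)"
      using ae rate_pos unfolding ae_curve_def by simp
    then show ?thesis
      unfolding modulus_def INF_less_iff by blast
  qed
  then obtain r where r: "\<And>n. r n \<in> borel_measurable borel" "\<And>n x. 0 \<le> r n x"
      "\<And>n \<gamma>. \<gamma> \<in> curves \<Longrightarrow> \<not> P \<gamma> \<Longrightarrow> 1 \<le> line_integral \<gamma> (r n)" "\<And>n. nrm (r n) < ennreal (rate n)"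
    by (metis (no_types, lifting) mem_Collect_eq)
  define \<rho> where "\<rho> n x = e2ennreal (r n x)" for n x
  have \<rho>: "\<rho> n \<in> borel_measurable borel" for n
    using r(1) unfolding \<rho>_def by measurable
  have wn: "wnorm (\<rho> n) \<le> ennreal (rate n)" for n
    using r(2,4) unfolding wnorm_def \<rho>_def by (simp add: enn2ereal_e2ennreal less_imp_le)
  have "P p" if p: "p \<in> curves" "curve_integral p (\<lambda>x. \<Sum>n. \<rho> n x) < \<infinity>" for p
  proof (rule ccontr)
    assume "\<not> P p"
    then have ge: "1 \<le> curve_integral p (\<rho> n)" for n
      using r(3)[OF p(1)] unfolding line_integral_eq \<rho>_def by simp
    have "(\<Sum>n. curve_integral p (\<rho> n)) < \<infinity>"
      using p(2) curve_integral_suminf[of p \<rho>] curve_measurable_borel[OF p(1) \<rho>] by simp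
    then have "(\<lambda>n. curve_integral p (\<rho> n)) \<longlonglongrightarrow> 0"
      by (rule ennreal_suminf_finite_imp_tendsto_0)
    then have "(1 :: ennreal) \<le> 0"
      by (rule LIMSEQ_le_const) (use ge in auto)
    then show False
      by simp
  qed
  moreover have "wnorm (\<lambda>x. \<Sum>n. \<rho> n x) < \<infinity>"
    using wnorm_suminf_le_1[OF borel_measurable_M[OF \<rho>] wn] by (auto intro: le_less_trans)
  moreover have "(\<lambda>x. \<Sum>n. \<rho> n x) \<in> borel_measurable borel"
    using \<rho> by measurable
  ultimately show "\<exists>\<rho>\<in>borel_measurable borel. wnorm \<rho> < \<infinity> \<and>
    (\<forall>p\<in>curves. curve_integral p \<rho> < \<infinity> \<longrightarrow> P p)"
    by blast
next
  assume "\<exists>\<rho>\<in>borel_measurable borel. wnorm \<rho> < \<infinity> \<and>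
    (\<forall>p\<in>curves. curve_integral p \<rho> < \<infinity> \<longrightarrow> P p)"
  then obtain \<rho> where \<rho>: "\<rho> \<in> borel_measurable borel" "wnorm \<rho> < \<infinity>"
    and P: "\<And>p. p \<in> curves \<Longrightarrow> curve_integral p \<rho> < \<infinity> \<Longrightarrow> P p"
    by blast
  obtain r where r: "wnorm \<rho> = ennreal r" "0 \<le> r"
    using \<rho>(2) by (cases "wnorm \<rho>") auto
  have "modulus nrm {p \<in> curves. \<not> P p} \<le> 0 + ennreal e" if e: "0 < e" for e
  proof -
    define a where "a = e / (r + 1)"
    have a: "0 < a" "a * r \<le> e"
      using e r by (auto simp: a_def field_simps)
    define s where "s x = enn2ereal (ennreal a * \<rho> x)" for x
    have "modulus nrm {p \<in> curves. \<not> P p} \<le> nrm s"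
      unfolding modulus_def
    proof (rule INF_lower, intro CollectI conjI ballI allI)
      show "s \<in> borel_measurable borel"
        using \<rho>(1) unfolding s_def by measurable
      show "0 \<le> s x" for x
        by (simp add: s_def)
      fix p assume "p \<in> {p \<in> curves. \<not> P p}"
      then have p: "p \<in> curves" "curve_integral p \<rho> = \<infinity>"
        using P[of p] by (auto simp: top.not_eq_extremum[symmetric])
      then show "1 \<le> line_integral p s"
        using a by (simp add: line_integral_eq s_def curve_integral_cmult
            curve_measurable_borel[OF p(1) \<rho>(1)] ennreal_mult_top)
    qed
    also have "nrm s = ennreal (a * r)"
      using wnorm_scale[OF borel_measurable_M[OF \<rho>(1)], of a] a r
      unfolding s_def by (simp add: wnorm_def[symmetric] ennreal_mult)
    finally show ?thesis
      using a by (simp add: ennreal_leI order_trans)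
  qed
  then show "ae_curve nrm P"
    unfolding ae_curve_def using ennreal_le_epsilon[of 0 "modulus nrm {p \<in> curves. \<not> P p}"] by auto
qed

lemma ae_curve_mono:
  assumes "ae_curve nrm P" "\<And>p. p \<in> curves \<Longrightarrow> P p \<Longrightarrow> Q p"
  shows "ae_curve nrm Q"
  using assms unfolding ae_curve_iff by blast

text \<open>
  Weights for the single properties can be scaled to norms below \<^const>\<open>rate\<close> without changing where their
  integrals are infinite; their sum then controls all of them.
\<close>

lemma ae_curve_all:
  fixes P :: "nat \<Rightarrow> real \<times> (real \<Rightarrow> 'a) \<Rightarrow> bool"
  assumes "\<And>n. ae_curve nrm (P n)"
  shows "ae_curve nrm (\<lambda>p. \<forall>n. P n p)"
proof -
  obtain \<rho> where \<rho>: "\<And>n. \<rho> n \<in> borel_measurable borel" "\<And>n. wnorm (\<rho> n) < \<infinity>"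
    and P: "\<And>n p. p \<in> curves \<Longrightarrow> curve_integral p (\<rho> n) < \<infinity> \<Longrightarrow> P n p"
    using assms unfolding ae_curve_iff by metis
  define a where "a n = rate n / (1 + enn2real (wnorm (\<rho> n)))" for n
  have a: "0 < a n" for n
    using rate_pos[of n] by (simp add: a_def add_pos_nonneg)
  define \<sigma> where "\<sigma> n x = ennreal (a n) * \<rho> n x" for n x
  have \<sigma>: "\<sigma> n \<in> borel_measurable borel" for n
    using \<rho>(1) unfolding \<sigma>_def by measurable
  have wn: "wnorm (\<sigma> n) \<le> ennreal (rate n)" for n
  proof -
    obtain r where r: "wnorm (\<rho> n) = ennreal r" "0 \<le> r"
      using \<rho>(2)[of n] by (cases "wnorm (\<rho> n)") auto
    have "wnorm (\<sigma> n) = ennreal (a n * r)"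
      using wnorm_scale[OF borel_measurable_M[OF \<rho>(1)], of "a n"] a[of n] r
      unfolding \<sigma>_def by (simp add: ennreal_mult)
    also have "a n * r \<le> rate n"
      using r rate_pos[of n] by (simp add: a_def field_simps)
    finally show ?thesis
      by (simp add: ennreal_leI)
  qed
  have "P n p" if p: "p \<in> curves" "curve_integral p (\<lambda>x. \<Sum>n. \<sigma> n x) < \<infinity>" for n p
  proof (rule P[OF p(1)])
    have fin: "(\<Sum>n. curve_integral p (\<sigma> n)) < \<infinity>"
      using p(2) curve_integral_suminf[of p \<sigma>] curve_measurable_borel[OF p(1) \<sigma>] by simp
    have "curve_integral p (\<sigma> n) \<le> (\<Sum>n. curve_integral p (\<sigma> n))"
      using sum_le_suminf[of "\<lambda>n. curve_integral p (\<sigma> n)" "{n}"] by simp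
    then have "curve_integral p (\<sigma> n) < \<infinity>"
      using fin by (rule le_less_trans)
    then show "curve_integral p (\<rho> n) < \<infinity>"
      using a[of n] unfolding \<sigma>_def
      by (auto simp: curve_integral_cmult curve_measurable_borel[OF p(1) \<rho>(1)]
          ennreal_mult_less_top)
  qed
  moreover have "wnorm (\<lambda>x. \<Sum>n. \<sigma> n x) < \<infinity>"
    using wnorm_suminf_le_1[OF borel_measurable_M[OF \<sigma>] wn] by (auto intro: le_less_trans)
  moreover have "(\<lambda>x. \<Sum>n. \<sigma> n x) \<in> borel_measurable borel"
    using \<sigma> by measurable
  ultimately show ?thesis
    unfolding ae_curve_iff by blast
qed

lemma ae_curve_conj:
  assumes "ae_curve nrm P" "ae_curve nrm Q"
  shows "ae_curve nrm (\<lambda>p. P p \<and> Q p)"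
proof -
  have "ae_curve nrm (\<lambda>p. \<forall>n::nat. if n = 0 then P p else Q p)"
  proof (rule ae_curve_all)
    show "ae_curve nrm (\<lambda>p. if n = 0 then P p else Q p)" for n :: nat
      using assms by (cases "n = 0") auto
  qed
  then show ?thesis
    by (rule ae_curve_mono) (metis zero_neq_one)
qed

text \<open>
  A weight with finite integral over a curve has finite integral over every initial segment.
\<close>

lemma ae_curve_initial:
  assumes "ae_curve nrm P"
  shows "ae_curve nrm (\<lambda>p. \<forall>t\<in>{0<..fst p}. P (t, snd p))"
proof -
  obtain \<rho> where \<rho>: "\<rho> \<in> borel_measurable borel" "wnorm \<rho> < \<infinity>"
    and P: "\<And>p. p \<in> curves \<Longrightarrow> curve_integral p \<rho> < \<infinity> \<Longrightarrow> P p"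
    using assms unfolding ae_curve_iff by blast
  show ?thesis
    unfolding ae_curve_iff
  proof (intro bexI[of _ \<rho>] conjI ballI impI)
    fix p :: "real \<times> (real \<Rightarrow> 'a)" and t
    assume "p \<in> curves" "curve_integral p \<rho> < \<infinity>" "t \<in> {0<..fst p}"
    then show "P (t, snd p)"
      by (cases p) (auto intro!: P intro: initial_segment_curves le_less_trans[OF curve_integral_initial])
  qed (use \<rho> in auto)
qed

text \<open>
  Almost every curve spends no time in a null set: the weight that is \<open>\<infinity>\<close> on a Borel null set
  and \<open>0\<close> elsewhere has norm zero.
\<close>

lemma ae_curve_AE:
  assumes "AE x in M. Q x"
  shows "ae_curve nrm (\<lambda>p. AE t in lebesgue_on {0..fst p}. Q (snd p t))"
proof -
  obtain D where D: "D \<in> sets borel" "D \<in> null_sets M" "\<And>x. x \<notin> D \<Longrightarrow> Q x"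
    using assms by (rule borel_null_superset) blast
  define \<rho> :: "'a \<Rightarrow> ennreal" where "\<rho> x = (if x \<in> D then \<infinity> else 0)" for x
  have \<rho>: "\<rho> \<in> borel_measurable borel"
    using D(1) unfolding \<rho>_def by measurable
  have "AE x in M. \<rho> x = 0"
    using AE_not_in[OF D(2)] by eventually_elim (simp add: \<rho>_def)
  then have "wnorm \<rho> = 0"
    using wnorm_eq_0_iff[OF borel_measurable_M[OF \<rho>]] by simp
  moreover have "AE t in lebesgue_on {0..fst p}. Q (snd p t)"
    if p: "p \<in> curves" "curve_integral p \<rho> < \<infinity>" for p
  proof -
    have "AE t in lebesgue_on {0..fst p}. \<rho> (snd p t) \<noteq> \<infinity>"
      using p curve_measurable_borel[OF p(1) \<rho>]
      unfolding curve_integral_def curve_measurable_def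
      by (intro nn_integral_PInf_AE) auto
    then show ?thesis
      by eventually_elim (use D(3) in \<open>auto simp: \<rho>_def split: if_splits\<close>)
  qed
  ultimately show ?thesis
    using \<rho> unfolding ae_curve_iff by (intro bexI[of _ \<rho>]) auto
qed

text \<open>
  Along almost every curve, \<^term>\<open>h\<close> agrees at almost every time with a Borel function, and Lebesgue
  measure is complete.
\<close>

lemma ae_curve_curve_measurable:
  assumes "h \<in> borel_measurable M"
  shows "ae_curve nrm (\<lambda>p. curve_measurable p h)"
proof -
  obtain h' where h': "h' \<in> borel_measurable borel" "AE x in M. h' x = h x"
    using borel_majorant[OF assms] by blast
  from ae_curve_AE[OF h'(2)] show ?thesis
  proof (rule ae_curve_mono)
    fix p :: "real \<times> (real \<Rightarrow> 'a)"
    assume p: "p \<in> curves" and ae: "AE t in lebesgue_on {0..fst p}. h' (snd p t) = h (snd p t)"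
    show "curve_measurable p h"
      unfolding curve_measurable_def
    proof (rule complete_measure.measurable_AE_eq)
      show "complete_measure (lebesgue_on {0..fst p})"
        by (simp add: complete_measure_lebesgue_on)
      show "(\<lambda>t. h' (snd p t)) \<in> borel_measurable (lebesgue_on {0..fst p})"
        using curve_measurable_borel[OF p h'(1)] by (simp add: curve_measurable_def)
    qed (rule ae)
  qed
qed

lemma ae_curve_integral_finite:
  assumes "h \<in> borel_measurable M" "wnorm h < \<infinity>"
  shows "ae_curve nrm (\<lambda>p. curve_integral p h < \<infinity>)"
proof -
  obtain h' where h': "h' \<in> borel_measurable borel" "\<And>x. h x \<le> h' x" "AE x in M. h' x = h x"
    using borel_majorant[OF assms(1)] by blast
  have "wnorm h' \<le> wnorm h"
    using h' assms(1) by (intro wnorm_mono) (auto intro: borel_measurable_M)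
  then have "wnorm h' < \<infinity>"
    using assms(2) by (rule le_less_trans)
  moreover have "curve_integral p h < \<infinity>" if "curve_integral p h' < \<infinity>" for p
    by (rule le_less_trans[OF curve_integral_mono_AE that]) (simp add: h'(2))
  ultimately show ?thesis
    unfolding ae_curve_iff using h'(1) by blast
qed

text \<open>
  A curve that spends no time in the exceptional null set cannot lie inside it, as its length is positive.
\<close>

lemma ae_curve_exists_point:
  assumes "AE x in M. Q x"
  shows "ae_curve nrm (\<lambda>p. \<exists>t\<in>{0..fst p}. Q (snd p t))"
  using ae_curve_AE[OF assms]
proof (rule ae_curve_mono)
  fix p :: "real \<times> (real \<Rightarrow> 'a)"
  assume p: "p \<in> curves" and ae: "AE t in lebesgue_on {0..fst p}. Q (snd p t)"
  show "\<exists>t\<in>{0..fst p}. Q (snd p t)"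
  proof (rule ccontr)
    assume "\<not> ?thesis"
    then have no: "\<And>t. t \<in> {0..fst p} \<Longrightarrow> \<not> Q (snd p t)"
      by blast
    have l: "0 < fst p"
      using p by (auto simp: curves_def)
    have "AE t in lebesgue_on {0..fst p}. False"
      using ae AE_space by eventually_elim (use no in \<open>auto simp: space_restrict_space\<close>)
    then have "ae_filter (lebesgue_on {0..fst p}) = bot"
      by (simp add: trivial_limit_def)
    then have "emeasure lebesgue {0..fst p} = 0"
      by (simp add: ae_filter_eq_bot_iff emeasure_restrict_space)
    then show False
      using l by simp
  qed
qed

end

section \<open>Curves through sets of capacity zero\<close>

text \<open>
  Comparing \<open>\<gamma>(s)\<close> and \<open>\<gamma>(t)\<close> through \<open>\<gamma>(0)\<close> costs a factor \<open>2\<close>, but only needs the upper gradient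
  inequality on initial segments, which are parameterized by arc length without any shift.
  By the convention for infinite values, a finite integral forces \<^term>\<open>u\<close> to be finite on the whole curve.
\<close>

lemma upper_gradient_oscillation:
  assumes g: "upper_gradient g u" and p: "(l, \<gamma>) \<in> curves"
    and s: "s \<in> {0..l}" and t: "t \<in> {0..l}"
  shows "e2ennreal \<bar>u (\<gamma> s)\<bar> \<le> e2ennreal \<bar>u (\<gamma> t)\<bar> + 2 * line_integral (l, \<gamma>) g"
proof (cases "line_integral (l, \<gamma>) g")
  case (real i)
  have seg: "\<bar>u (\<gamma> 0) - u (\<gamma> r)\<bar> \<le> ereal i" if r: "0 < r" "r \<le> l" for r
  proof -
    have "\<bar>u (\<gamma> 0) - u (\<gamma> r)\<bar> \<le> enn2ereal (line_integral (r, \<gamma>) g)"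
      using g initial_segment_curves[OF p r] unfolding upper_gradient_def by fastforce
    also have "\<dots> \<le> enn2ereal (line_integral (l, \<gamma>) g)"
      unfolding line_integral_eq using curve_integral_initial[OF r(2)] by (simp add: less_eq_ennreal.rep_eq)
    also have "\<dots> = ereal i"
      using real by (simp add: enn2ereal_ennreal)
    finally show ?thesis .
  qed
  have "0 < l"
    using p by (auto simp: curves_def)
  then obtain a where a: "u (\<gamma> 0) = ereal a"
    using seg[of l] by (cases "u (\<gamma> 0)"; cases "u (\<gamma> l)") auto
  have "\<exists>b. u (\<gamma> r) = ereal b \<and> \<bar>a - b\<bar> \<le> i" if "r \<in> {0..l}" for r
  proof (cases "r = 0")
    case True
    then show ?thesis using a real by simp
  next
    case False
    then show ?thesis
      using seg[of r] that a by (cases "u (\<gamma> r)") auto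
  qed
  then obtain b d where b: "u (\<gamma> s) = ereal b" "\<bar>a - b\<bar> \<le> i" and d: "u (\<gamma> t) = ereal d" "\<bar>a - d\<bar> \<le> i"
    using s t by meson
  have "ennreal \<bar>b\<bar> \<le> ennreal (\<bar>d\<bar> + 2 * i)"
    using b(2) d(2) by (intro ennreal_leI) linarith
  also have "\<dots> = ennreal \<bar>d\<bar> + 2 * ennreal i"
    using real by (simp add: ennreal_mult)
  finally show ?thesis
    by (simp add: real b(1) d(1) del: ennreal_plus line_integral.simps)
qed (simp add: ennreal_mult_top)

context quasi_Banach_function_lattice
begin

lemma wnorm_abs_le:
  assumes "u \<in> borel_measurable M"
  shows "wnorm (\<lambda>x. e2ennreal \<bar>u x\<bar>) \<le> nrm u"
  unfolding wnorm_def
proof (rule norm_mono)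
  show "(\<lambda>x. enn2ereal (e2ennreal \<bar>u x\<bar>)) \<in> borel_measurable M"
    using assms by measurable
qed (use assms in \<open>auto simp: enn2ereal_e2ennreal\<close>)

text \<open>
  Let \<open>u\<^sub>n \<ge> 1\<close> on \<^term>\<open>E\<close> with norms and upper gradient norms below \<^const>\<open>rate\<close>.  Almost every curve has
  a point where \<open>\<Sum>\<^sub>n \<bar>u\<^sub>n\<bar>\<close> converges, and the integrals of the upper gradients over it are summable.
  Since the oscillation along the curve is bounded by these integrals, \<open>u\<^sub>n \<rightarrow> 0\<close> at each of its points.
\<close>

lemma ae_curve_avoids_capacity_zero:
  assumes "sobolev_capacity M nrm E = 0"
  shows "ae_curve nrm (\<lambda>p. \<forall>t\<in>{0..fst p}. snd p t \<notin> E)"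
proof -
  have "\<exists>u g. u \<in> borel_measurable M \<and> (\<forall>x\<in>E. 1 \<le> u x) \<and> nrm u \<le> ennreal (rate n) \<and>
      upper_gradient g u \<and> nrm g \<le> ennreal (rate n)" for n
  proof -
    have "sobolev_capacity M nrm E < ennreal (rate n)"
      using assms rate_pos by simp
    then obtain u where u: "u \<in> borel_measurable M" "\<forall>x\<in>E. 1 \<le> u x"
        "newtonian_norm nrm u < ennreal (rate n)"
      unfolding sobolev_capacity_def INF_less_iff by blast
    have 1: "nrm u \<le> newtonian_norm nrm u"
      and 2: "(INF g \<in> {g. upper_gradient g u}. nrm g) \<le> newtonian_norm nrm u"
      unfolding newtonian_norm_def by simp_all
    from le_less_trans[OF 2 u(3)] obtain g where "upper_gradient g u" "nrm g < ennreal (rate n)"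
      unfolding INF_less_iff by blast
    with u le_less_trans[OF 1 u(3)] show ?thesis
      by (meson less_imp_le)
  qed
  then obtain u g where u: "\<And>n. u n \<in> borel_measurable M" "\<And>n x. x \<in> E \<Longrightarrow> 1 \<le> u n x"
      "\<And>n. nrm (u n) \<le> ennreal (rate n)"
    and g: "\<And>n. upper_gradient (g n) (u n)" "\<And>n. nrm (g n) \<le> ennreal (rate n)"
    by metis
  define v where "v n x = e2ennreal \<bar>u n x\<bar>" for n x
  define \<rho> where "\<rho> n x = e2ennreal (g n x)" for n x
  have v: "v n \<in> borel_measurable M" for n
    using u(1) unfolding v_def by measurable
  have "wnorm (v n) \<le> ennreal (rate n)" for n
    using wnorm_abs_le[OF u(1)] u(3) order_trans unfolding v_def by blast
  then have "wnorm (\<lambda>x. \<Sum>n. v n x) \<le> 1"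
    by (rule wnorm_suminf_le_1[OF v])
  then have "AE x in M. (\<Sum>n. v n x) < \<infinity>"
    using v by (intro wnorm_finite_imp_AE) (auto intro: le_less_trans)
  note 1 = ae_curve_exists_point[OF this]
  have gb: "g n \<in> borel_measurable borel" "0 \<le> g n x" for n x
    using g(1) by (auto simp: upper_gradient_def)
  have \<rho>: "\<rho> n \<in> borel_measurable borel" for n
    using gb(1) unfolding \<rho>_def by measurable
  have "wnorm (\<rho> n) \<le> ennreal (rate n)" for n
    using g(2) gb(2) unfolding wnorm_def \<rho>_def by (simp add: enn2ereal_e2ennreal)
  then have "wnorm (\<lambda>x. \<Sum>n. \<rho> n x) \<le> 1"
    by (rule wnorm_suminf_le_1[OF borel_measurable_M[OF \<rho>]])
  then have 2: "ae_curve nrm (\<lambda>p. curve_integral p (\<lambda>x. \<Sum>n. \<rho> n x) < \<infinity>)"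
    using borel_measurable_M[OF \<rho>] by (intro ae_curve_integral_finite) (auto intro: le_less_trans)
  from ae_curve_conj[OF 1 2] show ?thesis
  proof (rule ae_curve_mono)
    fix p :: "real \<times> (real \<Rightarrow> 'a)"
    assume p: "p \<in> curves"
      and *: "(\<exists>t\<in>{0..fst p}. (\<Sum>n. v n (snd p t)) < \<infinity>) \<and>
        curve_integral p (\<lambda>x. \<Sum>n. \<rho> n x) < \<infinity>"
    obtain l \<gamma> where lg: "p = (l, \<gamma>)" by (cases p)
    obtain t where t: "t \<in> {0..l}" "(\<Sum>n. v n (\<gamma> t)) < \<infinity>"
      using * lg by auto
    have "(\<Sum>n. curve_integral p (\<rho> n)) < \<infinity>"
      using * curve_integral_suminf[of p \<rho>] curve_measurable_borel[OF p \<rho>] by simp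
    then have "(\<lambda>n. v n (\<gamma> t) + 2 * curve_integral p (\<rho> n)) \<longlonglongrightarrow> 0 + 2 * 0"
      using t(2) by (intro tendsto_intros ennreal_suminf_finite_imp_tendsto_0 ennreal_tendsto_cmult) auto
    then have lim: "(\<lambda>n. v n (\<gamma> t) + 2 * curve_integral p (\<rho> n)) \<longlonglongrightarrow> 0"
      by simp
    have "\<gamma> s \<notin> E" if s: "s \<in> {0..l}" for s
    proof
      assume sE: "\<gamma> s \<in> E"
      have "1 \<le> v n (\<gamma> t) + 2 * curve_integral p (\<rho> n)" for n
      proof -
        have "(1::ereal) \<le> \<bar>u n (\<gamma> s)\<bar>"
          using u(2)[OF sE, of n] by (cases "u n (\<gamma> s)") auto
        then have "1 \<le> v n (\<gamma> s)"
          unfolding v_def by (metis e2ennreal_mono one_ennreal.abs_eq)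
        also have "\<dots> \<le> v n (\<gamma> t) + 2 * curve_integral p (\<rho> n)"
          using upper_gradient_oscillation[OF g(1) p[unfolded lg] s t(1), of n]
          unfolding v_def \<rho>_def lg line_integral_eq .
        finally show ?thesis .
      qed
      then have "(1 :: ennreal) \<le> 0"
        by (intro LIMSEQ_le_const[OF lim]) auto
      then show False by simp
    qed
    then show "\<forall>t\<in>{0..fst p}. snd p t \<notin> E"
      by (simp add: lg)
  qed
qed

section \<open>Fuglede's lemma\<close>

text \<open>
  Along a subsequence with \<open>\<parallel>g\<^sub>k - g\<parallel>\<close> below \<^const>\<open>rate\<close>, the series of the differences has finite norm, so its
  integral over almost every curve is finite and its terms tend to \<open>0\<close>.  Where both functions are
  infinite the difference is \<open>\<infinity>\<close>, which keeps \<open>g\<^sub>k \<le> g + \<bar>g\<^sub>k - g\<bar>\<close> valid at every point.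
\<close>

lemma fuglede_subsequence:
  assumes conv: "converges_in M nrm gs g" and gs: "\<And>k. gs k \<in> borel_measurable M"
  obtains k where "\<And>j::nat. j \<le> k j"
    "ae_curve nrm (\<lambda>p. (\<lambda>j. curve_integral p (\<lambda>x. e2ennreal \<bar>gs (k j) x - g x\<bar>)) \<longlonglongrightarrow> 0)"
proof -
  have g: "g \<in> borel_measurable M" and lim: "(\<lambda>n. nrm (\<lambda>x. gs n x - g x)) \<longlonglongrightarrow> 0"
    using conv by (auto simp: converges_in_def lattice_space_def)
  have "\<exists>n\<ge>j. nrm (\<lambda>x. gs n x - g x) < ennreal (rate j)" for j
  proof -
    have "eventually (\<lambda>n. nrm (\<lambda>x. gs n x - g x) < ennreal (rate j)) sequentially"
      using lim rate_pos[of j] by (intro order_tendstoD(2)) auto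
    then show ?thesis
      unfolding eventually_sequentially by (meson max.cobounded1 max.cobounded2)
  qed
  then obtain k where k: "\<And>j. j \<le> k j" "\<And>j. nrm (\<lambda>x. gs (k j) x - g x) < ennreal (rate j)"
    by metis
  define h where "h j x = e2ennreal \<bar>gs (k j) x - g x\<bar>" for j x
  have h: "h j \<in> borel_measurable M" for j
    using g gs unfolding h_def by measurable
  have "wnorm (h j) \<le> ennreal (rate j)" for j
  proof -
    have "(\<lambda>x. gs (k j) x - g x) \<in> borel_measurable M"
      using g gs by measurable
    from wnorm_abs_le[OF this] k(2)[of j] show ?thesis
      unfolding h_def by simp
  qed
  then have "wnorm (\<lambda>x. \<Sum>j. h j x) \<le> 1"
    by (rule wnorm_suminf_le_1[OF h])
  then have "ae_curve nrm (\<lambda>p. curve_integral p (\<lambda>x. \<Sum>j. h j x) < \<infinity>)"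
    using h by (intro ae_curve_integral_finite) (auto intro: le_less_trans)
  moreover have "ae_curve nrm (\<lambda>p. \<forall>j. curve_measurable p (h j))"
    by (intro ae_curve_all ae_curve_curve_measurable h)
  ultimately have "ae_curve nrm (\<lambda>p. curve_integral p (\<lambda>x. \<Sum>j. h j x) < \<infinity> \<and> (\<forall>j. curve_measurable p (h j)))"
    by (rule ae_curve_conj)
  then have "ae_curve nrm (\<lambda>p. (\<lambda>j. curve_integral p (h j)) \<longlonglongrightarrow> 0)"
    by (rule ae_curve_mono) (auto intro!: ennreal_suminf_finite_imp_tendsto_0 simp: curve_integral_suminf)
  then show thesis
    using that k(1) unfolding h_def by blast
qed

end

section \<open>Passing to the limit along a curve\<close>

text \<open>
  Subtraction of extended reals is continuous except at pairs of equal infinities, and these are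
  excluded when one end value is finite.  The right-hand sides are controlled by
  \<open>\<integral>\<^sub>\<gamma> g\<^sub>j \<le> \<integral>\<^sub>\<gamma> g + \<integral>\<^sub>\<gamma> \<bar>g\<^sub>j - g\<bar>\<close>.
\<close>

lemma gradient_inequality_limit:
  fixes f g :: "'a \<Rightarrow> ereal"
  assumes lim: "(\<lambda>j. fs j (\<gamma> 0)) \<longlonglongrightarrow> f (\<gamma> 0)" "(\<lambda>j. fs j (\<gamma> l)) \<longlonglongrightarrow> f (\<gamma> l)"
    and fin: "\<bar>f (\<gamma> 0)\<bar> \<noteq> \<infinity> \<or> \<bar>f (\<gamma> l)\<bar> \<noteq> \<infinity>"
    and grad: "\<And>j. gradient_inequality (gs j) (fs j) (l, \<gamma>)"
    and nonneg: "\<And>j x. 0 \<le> gs j x" "\<And>x. 0 \<le> g x"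
    and g: "curve_measurable (l, \<gamma>) (\<lambda>x. e2ennreal (g x))"
    and h: "\<And>j. curve_measurable (l, \<gamma>) (\<lambda>x. e2ennreal \<bar>gs j x - g x\<bar>)"
    and lim0: "(\<lambda>j. curve_integral (l, \<gamma>) (\<lambda>x. e2ennreal \<bar>gs j x - g x\<bar>)) \<longlonglongrightarrow> 0"
  shows "gradient_inequality g f (l, \<gamma>)"
proof -
  let ?I = "curve_integral (l, \<gamma>)"
  have le: "\<bar>fs j (\<gamma> 0) - fs j (\<gamma> l)\<bar>
      \<le> enn2ereal (?I (\<lambda>x. e2ennreal (g x)) + ?I (\<lambda>x. e2ennreal \<bar>gs j x - g x\<bar>))" for j
  proof -
    have "e2ennreal (gs j x) \<le> e2ennreal (g x) + e2ennreal \<bar>gs j x - g x\<bar>" for x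
      using nonneg(1)[of j x] nonneg(2)[of x]
      by (cases "gs j x"; cases "g x") (auto simp: ennreal_plus[symmetric] simp del: ennreal_plus intro!: ennreal_leI)
    then have "?I (\<lambda>x. e2ennreal (gs j x)) \<le> ?I (\<lambda>x. e2ennreal (g x) + e2ennreal \<bar>gs j x - g x\<bar>)"
      by (intro curve_integral_mono_AE) simp
    also have "\<dots> = ?I (\<lambda>x. e2ennreal (g x)) + ?I (\<lambda>x. e2ennreal \<bar>gs j x - g x\<bar>)"
      by (rule curve_integral_add[OF g h])
    finally show ?thesis
      using grad[of j] unfolding gradient_inequality.simps line_integral_eq
      by (metis less_eq_ennreal.rep_eq order_trans)
  qed
  have "(\<lambda>j. \<bar>fs j (\<gamma> 0) - fs j (\<gamma> l)\<bar>) \<longlonglongrightarrow> \<bar>f (\<gamma> 0) - f (\<gamma> l)\<bar>"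
    using lim fin by (intro tendsto_abs_ereal tendsto_diff_ereal_general) auto
  moreover have "(\<lambda>j. enn2ereal (?I (\<lambda>x. e2ennreal (g x)) + ?I (\<lambda>x. e2ennreal \<bar>gs j x - g x\<bar>)))
      \<longlonglongrightarrow> enn2ereal (?I (\<lambda>x. e2ennreal (g x)) + 0)"
    by (intro tendsto_enn2erealI tendsto_add tendsto_const lim0)
  ultimately have "\<bar>f (\<gamma> 0) - f (\<gamma> l)\<bar> \<le> enn2ereal (?I (\<lambda>x. e2ennreal (g x)) + 0)"
    by (rule LIMSEQ_le) (use le in auto)
  then show ?thesis
    unfolding gradient_inequality.simps line_integral_eq by simp
qed

text \<open>
  If \<open>f(\<gamma>(0))\<close> is infinite and \<open>f(\<gamma>(t))\<close> is finite, the inequality on the initial segment \<open>[0, t]\<close> reads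
  \<open>\<infinity> \<le> \<integral> g\<close>, so the integral over the whole curve is infinite as well.
\<close>

lemma gradient_inequality_infinite_ends:
  assumes t: "t \<in> {0..l}" "\<bar>f (\<gamma> t)\<bar> \<noteq> \<infinity>"
    and grad: "\<And>t. 0 < t \<Longrightarrow> t \<le> l \<Longrightarrow> \<bar>f (\<gamma> 0)\<bar> \<noteq> \<infinity> \<or> \<bar>f (\<gamma> t)\<bar> \<noteq> \<infinity> \<Longrightarrow>
      gradient_inequality g f (t, \<gamma>)"
    and l: "0 < l"
  shows "gradient_inequality g f (l, \<gamma>)"
proof (cases "\<bar>f (\<gamma> 0)\<bar> \<noteq> \<infinity>")
  case True
  then show ?thesis using grad[of l] l by (metis order_refl)
next
  case False
  then have "0 < t"
    using t by (cases "t = 0") auto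
  then have "\<bar>f (\<gamma> 0) - f (\<gamma> t)\<bar> \<le> enn2ereal (line_integral (t, \<gamma>) g)"
    using grad[of t] t by simp
  moreover have "\<bar>f (\<gamma> 0) - f (\<gamma> t)\<bar> = \<infinity>"
    using False t(2) by (cases "f (\<gamma> 0)"; cases "f (\<gamma> t)") auto
  ultimately have "\<infinity> \<le> enn2ereal (line_integral (t, \<gamma>) g)"
    by simp
  also have "\<dots> \<le> enn2ereal (line_integral (l, \<gamma>) g)"
    using t(1) curve_integral_initial[of t l] unfolding line_integral_eq
    by (simp add: less_eq_ennreal.rep_eq)
  finally show ?thesis
    by simp
qed

theorem proposition5p9:
  fixes M :: "'a::metric_space measure"
    and nrm :: "('a \<Rightarrow> ereal) \<Rightarrow> ennreal"
    and c :: real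
    and f :: "'a \<Rightarrow> ereal" and g :: "'a \<Rightarrow> ereal"
    and fs :: "nat \<Rightarrow> 'a \<Rightarrow> ereal" and gs :: "nat \<Rightarrow> 'a \<Rightarrow> ereal"
  assumes "quasi_Banach_function_lattice M nrm c"
    and "continuous_quasi_norm M nrm"
    and "\<And>k. fs k \<in> dirichlet_space M nrm"
    and "\<And>k. gs k \<in> lattice_space M nrm"
    and "\<And>k. weak_upper_gradient M nrm (gs k) (fs k)"
    and "quasi_everywhere M nrm (\<lambda>x. (\<lambda>k. fs k x) \<longlonglongrightarrow> f x)"
    and "converges_in M nrm gs g"
    and "AE x in M. \<bar>f x\<bar> \<noteq> \<infinity>"
    and "\<And>x. 0 \<le> g x"
  shows "weak_upper_gradient M nrm g f"
proof -
  interpret quasi_Banach_function_lattice M nrm c by fact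
  let ?h = "\<lambda>k x. e2ennreal \<bar>gs k x - g x\<bar>"
  have gM: "g \<in> borel_measurable M"
    using assms(7) by (auto simp: converges_in_def lattice_space_def)
  have gsM: "gs k \<in> borel_measurable M" for k
    using assms(4)[of k] by (auto simp: lattice_space_def)
  have gs0: "0 \<le> gs k x" for k x
    using assms(5)[of k] by (simp add: weak_upper_gradient_def)
  obtain k where k: "\<And>j. j \<le> k j"
    and int0: "ae_curve nrm (\<lambda>p. (\<lambda>j. curve_integral p (?h (k j))) \<longlonglongrightarrow> 0)"
    using fuglede_subsequence[OF assms(7) gsM] by blast
  \<comment> \<open>all that is needed to pass to the limit on one curve; it will be used on initial segments\<close>
  define R where "R p \<longleftrightarrow> curve_measurable p (\<lambda>x. e2ennreal (g x)) \<and>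
      (\<forall>t\<in>{0..fst p}. (\<lambda>j. fs j (snd p t)) \<longlonglongrightarrow> f (snd p t)) \<and>
      (\<forall>j. gradient_inequality (gs j) (fs j) p) \<and>
      (\<forall>j. curve_measurable p (?h j)) \<and>
      (\<lambda>j. curve_integral p (?h (k j))) \<longlonglongrightarrow> 0" for p
  have "ae_curve nrm R"
    unfolding R_def
  proof (intro ae_curve_conj ae_curve_all int0 ae_curve_curve_measurable)
    show "(\<lambda>x. e2ennreal (g x)) \<in> borel_measurable M"
      using gM by measurable
    show "(\<lambda>x. e2ennreal \<bar>gs j x - g x\<bar>) \<in> borel_measurable M" for j
      using gM gsM by measurable
    show "ae_curve nrm (\<lambda>p. \<forall>t\<in>{0..fst p}. (\<lambda>j. fs j (snd p t)) \<longlonglongrightarrow> f (snd p t))"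
      using ae_curve_avoids_capacity_zero[OF assms(6)[unfolded quasi_everywhere_def]] by simp
    show "ae_curve nrm (gradient_inequality (gs j) (fs j))" for j
      using assms(5)[of j] unfolding weak_upper_gradient_def by (auto intro: ae_curve_mono)
  qed
  then have "ae_curve nrm (\<lambda>p. (\<forall>t\<in>{0<..fst p}. R (t, snd p)) \<and> (\<exists>t\<in>{0..fst p}. \<bar>f (snd p t)\<bar> \<noteq> \<infinity>))"
    by (intro ae_curve_conj ae_curve_initial ae_curve_exists_point assms(8))
  then have "ae_curve nrm (\<lambda>p. line_measurable p g \<and> gradient_inequality g f p)"
  proof (rule ae_curve_mono)
    fix p :: "real \<times> (real \<Rightarrow> 'a)"
    assume p: "p \<in> curves"
      and *: "(\<forall>t\<in>{0<..fst p}. R (t, snd p)) \<and> (\<exists>t\<in>{0..fst p}. \<bar>f (snd p t)\<bar> \<noteq> \<infinity>)"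
    obtain l \<gamma> where lg: "p = (l, \<gamma>)" by (cases p)
    have l: "0 < l"
      using p by (simp add: lg curves_def)
    have R: "R (t, \<gamma>)" if "0 < t" "t \<le> l" for t
      using * that by (simp add: lg)
    have grad: "gradient_inequality g f (t, \<gamma>)"
      if t: "0 < t" "t \<le> l" and fin: "\<bar>f (\<gamma> 0)\<bar> \<noteq> \<infinity> \<or> \<bar>f (\<gamma> t)\<bar> \<noteq> \<infinity>" for t
    proof (rule gradient_inequality_limit[where fs = "\<lambda>j. fs (k j)" and gs = "\<lambda>j. gs (k j)"])
      have "filterlim k at_top sequentially"
        using k by (rule filterlim_at_top_mono[OF filterlim_ident always_eventually, rule_format])
      note sub = filterlim_compose[OF _ this]
      show "(\<lambda>j. fs (k j) (\<gamma> 0)) \<longlonglongrightarrow> f (\<gamma> 0)" "(\<lambda>j. fs (k j) (\<gamma> t)) \<longlonglongrightarrow> f (\<gamma> t)"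
        using R[OF t] t by (auto simp: R_def intro!: sub)
    qed (use R[OF t] fin gs0 assms(9) in \<open>simp_all add: R_def del: gradient_inequality.simps\<close>)
    obtain t where "t \<in> {0..l}" "\<bar>f (\<gamma> t)\<bar> \<noteq> \<infinity>"
      using * by (auto simp: lg)
    then have "gradient_inequality g f (l, \<gamma>)"
      using grad l by (rule gradient_inequality_infinite_ends)
    moreover have "line_measurable p g"
      using R[of l] l by (simp add: line_measurable_iff assms(9) R_def lg del: line_measurable.simps)
    ultimately show "line_measurable p g \<and> gradient_inequality g f p"
      by (simp add: lg)
  qed
  then show ?thesis
    using gM assms(9) unfolding weak_upper_gradient_def by blast
qed

end
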